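(* Let $-1\le B<A\le 1$ and $f\in\mathcal{C}(A,B)$. (i) If $(A,B)\in E_1\cup E_2$, then $$\|S_f\|\le\begin{cases}2, & B=-1,\\ A-B, & B\ne-1,\ |A+B|\le 2(1-B^2),\\ (A-B)\gamma(\alpha), & B\ne -1,\ |A+B|>2(1-B^2),\end{cases}$$ where $\gamma(t)=\dfrac{(1-t^2)(2-|A+B|(1-t^2))}{2-|A+B|(1-t^2)-2B^2t^2}$ and $\alpha$ is the unique root in $(0,1)$ of $h(t)=0$, with $h(t)=(2-|A+B|)(|A+B|+2B^2-2)-2|A+B|(2-|A+B|)t^2+|A+B|(2B^2-|A+B|)t^4$. (ii) If $(A,B)\in E_3$, then $$\|S_f\|\le \frac{2|A^2-B^2|\,(1-\sqrt{1-B^2})^2}{B^4}.$$ Moreover, every one of these estimates is sharp, i.e. for each case there is a function in $\mathcal{C}(A,B)$ attaining the bound as the value of (or supremum defining) its Schwarzian norm.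
   Context: $\mathbb{D}$ is the unit disk; $\mathcal{C}(A,B)$ for $-1\le B<A\le1$ is the set of analytic $f$ on $\mathbb{D}$ with $f(0)=0,f'(0)=1$, $f'\ne0$, and $1+\frac{zf''(z)}{f'(z)}\prec\frac{1+Az}{1+Bz}$, where $F\prec G$ means $F=G\circ\omega$ for some analytic $\omega:\mathbb{D}\to\mathbb{D}$ with $\omega(0)=0$. Schwarzian derivative $S_f=(f''/f')'-\frac12(f''/f')^2$; Schwarzian norm $\|S_f\|=\sup_{z\in\mathbb{D}}(1-|z|^2)^2|S_f(z)|$. $E=\{(A,B):-1\le B<A\le1\}$; $E_1=\{(A,B)\in E:1-\sqrt{1-B^2}<|A+B|<1+\sqrt{1-B^2}\}$, $E_2=\{(A,B)\in E:|A+B|\le 1-\sqrt{1-B^2},\ |A+B|\le|B|\}$, $E_3=\{(A,B)\in E:|A+B|\ge 1+\sqrt{1-B^2},\ |A+B|>|B|\}$. *)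

theory Defs
  imports "HOL-Complex_Analysis.Complex_Analysis"
begin

definition unit_disk :: "complex set" where
  "unit_disk = ball 0 1"

definition subordinate :: "(complex \<Rightarrow> complex) \<Rightarrow> (complex \<Rightarrow> complex) \<Rightarrow> bool" where
  "subordinate F G \<longleftrightarrow>
     (\<exists>\<omega>. \<omega> holomorphic_on unit_disk \<and> \<omega> ` unit_disk \<subseteq> unit_disk \<and> \<omega> 0 = 0 \<and>
          (\<forall>z\<in>unit_disk. F z = G (\<omega> z)))"

definition class_C :: "real \<Rightarrow> real \<Rightarrow> (complex \<Rightarrow> complex) set" where
  "class_C A B = {f. f holomorphic_on unit_disk \<and> f 0 = 0 \<and> deriv f 0 = 1 \<and>
       (\<forall>z\<in>unit_disk. deriv f z \<noteq> 0) \<and>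
       subordinate (\<lambda>z. 1 + z * deriv (deriv f) z / deriv f z)
                   (\<lambda>z. (1 + of_real A * z) / (1 + of_real B * z))}"

definition schwarzian :: "(complex \<Rightarrow> complex) \<Rightarrow> complex \<Rightarrow> complex" where
  "schwarzian f z = deriv (\<lambda>w. deriv (deriv f) w / deriv f w) z
                    - (1/2) * (deriv (deriv f) z / deriv f z)^2"

text \<open>Schwarzian norm, as an extended real (a priori it may be infinite).\<close>
definition schwarzian_norm :: "(complex \<Rightarrow> complex) \<Rightarrow> ereal" where
  "schwarzian_norm f = (SUP z\<in>unit_disk. ereal ((1 - (cmod z)^2)^2 * cmod (schwarzian f z)))"

definition E :: "(real \<times> real) set" where
  "E = {(A,B). -1 \<le> B \<and> B < A \<and> A \<le> 1}"

definition E1 :: "(real \<times> real) set" where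
  "E1 = {(A,B). (A,B) \<in> E \<and> 1 - sqrt (1 - B^2) < \<bar>A+B\<bar> \<and> \<bar>A+B\<bar> < 1 + sqrt (1 - B^2)}"

definition E2 :: "(real \<times> real) set" where
  "E2 = {(A,B). (A,B) \<in> E \<and> \<bar>A+B\<bar> \<le> 1 - sqrt (1 - B^2) \<and> \<bar>A+B\<bar> \<le> \<bar>B\<bar>}"

definition E3 :: "(real \<times> real) set" where
  "E3 = {(A,B). (A,B) \<in> E \<and> \<bar>A+B\<bar> \<ge> 1 + sqrt (1 - B^2) \<and> \<bar>A+B\<bar> > \<bar>B\<bar>}"

definition h_poly :: "real \<Rightarrow> real \<Rightarrow> real \<Rightarrow> real" where
  "h_poly A B t = (2 - \<bar>A+B\<bar>) * (\<bar>A+B\<bar> + 2*B^2 - 2) - 2*\<bar>A+B\<bar>*(2 - \<bar>A+B\<bar>)*t^2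
                  + \<bar>A+B\<bar>*(2*B^2 - \<bar>A+B\<bar>)*t^4"

definition gamma_fun :: "real \<Rightarrow> real \<Rightarrow> real \<Rightarrow> real" where
  "gamma_fun A B t = ((1 - t^2) * (2 - \<bar>A+B\<bar>*(1 - t^2))) / (2 - \<bar>A+B\<bar>*(1 - t^2) - 2*B^2*t^2)"

definition alpha_root :: "real \<Rightarrow> real \<Rightarrow> real" where
  "alpha_root A B = (THE t. 0 < t \<and> t < 1 \<and> h_poly A B t = 0)"

definition bound12 :: "real \<Rightarrow> real \<Rightarrow> real" where
  "bound12 A B =
     (if B = -1 then 2
      else if \<bar>A+B\<bar> \<le> 2*(1 - B^2) then A - B
      else (A - B) * gamma_fun A B (alpha_root A B))"

definition bound3 :: "real \<Rightarrow> real \<Rightarrow> real" where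
  "bound3 A B = 2 * \<bar>A^2 - B^2\<bar> * (1 - sqrt (1 - B^2))^2 / B^4"

end

theory Submission
  imports Defs
begin

text \<open>Writing the Schwarz function of the subordination as \<open>z \<phi>(z)\<close> with \<open>\<bar>\<phi>\<bar> \<le> 1\<close> gives
  \<open>S\<^sub>f = (A - B) (\<phi>' - (A + B) \<phi>\<^sup>2 / 2) / (1 + B z \<phi>)\<^sup>2\<close>. By Schwarz--Pick, with \<open>r = \<bar>z\<bar>\<close>,
  \<open>s = \<bar>\<phi>(z)\<bar>\<close>, \<open>c = \<bar>A + B\<bar>\<close>, \<open>b = \<bar>B\<bar>\<close> and \<open>k = 1 - c (1 - r\<^sup>2) / 2\<close>, the weighted Schwarzian is
  at most \<open>(A - B) (1 - r\<^sup>2) (1 - k s\<^sup>2) / (1 - b r s)\<^sup>2\<close>. Over all real \<open>s\<close> this is largest at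
  \<open>s = b r / k\<close>, with value \<open>(A - B) \<gamma>(r)\<close>; in the region \<open>E\<^sub>3\<close> that point exceeds 1 for
  intermediate \<open>r\<close>, and the maximum is taken there, at \<open>s = 1\<close>. Equality holds for \<open>\<phi> = 1\<close> in
  \<open>E\<^sub>3\<close>, and otherwise for some \<open>\<phi>(z) = \<plusminus>(z - p) / (1 - p z)\<close> with real \<open>p\<close>, having the required
  values of \<open>\<phi>\<close> and \<open>\<phi>'\<close> at a real point; when \<open>B = -1\<close> that point tends to 1.\<close>

section \<open>The Schwarz--Pick lemma\<close>

text \<open>The bound is non-strict so that unimodular constants belong to the set:
  \<open>\<phi> = 1\<close> is the extremal function in \<open>E3\<close>.\<close>

definition schur :: "(complex \<Rightarrow> complex) set" where
  "schur = {\<phi>. \<phi> holomorphic_on unit_disk \<and> (\<forall>z\<in>unit_disk. cmod (\<phi> z) \<le> 1)}"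

lemma mem_unit_disk [simp]: "z \<in> unit_disk \<longleftrightarrow> cmod z < 1"
  by (simp add: unit_disk_def)

lemma open_unit_disk [simp]: "open unit_disk"
  by (simp add: unit_disk_def)

lemma one_minus_mult_nonzero:
  fixes a b :: complex
  assumes "cmod a \<le> 1" "cmod b < 1"
  shows "1 - a * b \<noteq> 0" "1 + a * b \<noteq> 0"
proof -
  have "cmod (a * b) \<le> 1 * cmod b"
    unfolding norm_mult using assms by (intro mult_right_mono) auto
  then have *: "cmod (a * b) < 1"
    using assms by linarith
  show "1 - a * b \<noteq> 0"
    using * by (metis less_irrefl norm_one right_minus_eq)
  show "1 + a * b \<noteq> 0"
    using * by (metis add_eq_0_iff less_irrefl norm_minus_cancel norm_one)
qed

lemma Moebius_function_deriv:
  assumes "cmod w < 1" "cmod z < 1"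
  shows "(Moebius_function 0 w has_field_derivative
            of_real (1 - (cmod w)\<^sup>2) / (1 - cnj w * z)\<^sup>2) (at z)"
proof -
  have nz: "1 - cnj w * z \<noteq> 0"
    using one_minus_mult_nonzero[of "cnj w" z] assms by simp
  have eq: "complex_of_real (1 - (cmod w)\<^sup>2) = 1 - w * cnj w"
    by (metis complex_norm_square of_real_1 of_real_diff)
  have "((\<lambda>z. (z - w) / (1 - cnj w * z)) has_field_derivative
            (1 - w * cnj w) / (1 - cnj w * z)\<^sup>2) (at z)"
    using nz by (auto intro!: derivative_eq_intros simp: field_simps power2_eq_square)
  then show ?thesis
    by (simp add: eq Moebius_function_simple[abs_def] del: of_real_diff)
qed

text \<open>Disk automorphisms moving 0 to \<open>z\<close> beforehand and \<open>\<phi> z\<close>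
  to 0 afterwards turn \<open>\<phi>\<close> into a self-map \<open>g\<close> of the disk fixing 0.
  The Schwarz lemma gives \<open>cmod (deriv g 0) \<le> 1\<close>, and the chain rule rewrites this
  as the claim.\<close>

lemma Schwarz_Pick_strict:
  assumes hol: "\<phi> holomorphic_on unit_disk"
    and lt: "\<And>z. cmod z < 1 \<Longrightarrow> cmod (\<phi> z) < 1" and z: "cmod z < 1"
  shows "cmod (deriv \<phi> z) * (1 - (cmod z)\<^sup>2) \<le> 1 - (cmod (\<phi> z))\<^sup>2"
proof -
  define w where "w = \<phi> z"
  have w: "cmod w < 1"
    using lt z by (simp add: w_def)
  have w2: "(cmod w)\<^sup>2 < 1" and z2: "(cmod z)\<^sup>2 < 1"
    using w z by (simp_all add: abs_square_less_1)
  define g where "g = (\<lambda>\<zeta>. Moebius_function 0 w (\<phi> (Moebius_function 0 (-z) \<zeta>)))"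
  have M0: "Moebius_function 0 (-z) 0 = z"
    by (simp add: Moebius_function_of_zero)
  have Mlt: "cmod (Moebius_function 0 (-z) \<zeta>) < 1" if "cmod \<zeta> < 1" for \<zeta>
    using Moebius_function_norm_lt_1[of "-z" \<zeta> 0] z that by simp
  have "g holomorphic_on ball 0 1"
  proof -
    have 1: "Moebius_function 0 (-z) holomorphic_on ball 0 1"
      by (rule Moebius_function_holomorphic) (simp add: z)
    have 2: "\<phi> \<circ> Moebius_function 0 (-z) holomorphic_on ball 0 1"
      by (rule holomorphic_on_compose_gen[OF 1]) (use hol Mlt in \<open>auto simp: unit_disk_def\<close>)
    have "Moebius_function 0 w \<circ> (\<phi> \<circ> Moebius_function 0 (-z)) holomorphic_on ball 0 1"
      by (rule holomorphic_on_compose_gen[OF 2 Moebius_function_holomorphic[OF w]])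
        (use lt Mlt in auto)
    then show ?thesis
      by (simp add: g_def o_def)
  qed
  moreover have "g 0 = 0"
    by (simp add: g_def M0 w_def Moebius_function_eq_zero)
  moreover have "cmod (g \<zeta>) < 1" if "cmod \<zeta> < 1" for \<zeta>
    unfolding g_def by (intro Moebius_function_norm_lt_1 w lt Mlt that)
  ultimately have le: "cmod (deriv g 0) \<le> 1"
    using Schwarz_Lemma(2)[of g 0] by simp
  have d1: "(Moebius_function 0 (-z) has_field_derivative of_real (1 - (cmod z)\<^sup>2)) (at 0)"
    using Moebius_function_deriv[of "-z" 0] z by simp
  have "(\<phi> has_field_derivative deriv \<phi> z) (at z)"
    using hol z by (intro holomorphic_derivI[of _ unit_disk]) auto
  then have d2: "((\<lambda>\<zeta>. \<phi> (Moebius_function 0 (-z) \<zeta>)) has_field_derivative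
       deriv \<phi> z * of_real (1 - (cmod z)\<^sup>2)) (at 0)"
    using DERIV_chain2[OF _ d1, of \<phi> "deriv \<phi> z"] by (simp only: M0)
  have "1 - cnj w * w = of_real (1 - (cmod w)\<^sup>2)"
    by (metis complex_norm_square mult.commute of_real_1 of_real_diff)
  then have "(Moebius_function 0 w has_field_derivative 1 / of_real (1 - (cmod w)\<^sup>2)) (at w)"
    using Moebius_function_deriv[OF w w] w2 by (simp add: power2_eq_square del: of_real_diff)
  then have "(g has_field_derivative
        1 / of_real (1 - (cmod w)\<^sup>2) * (deriv \<phi> z * of_real (1 - (cmod z)\<^sup>2))) (at 0)"
    unfolding g_def using DERIV_chain2[OF _ d2, of "Moebius_function 0 w"] by (simp only: M0 w_def)
  then have "deriv g 0 = 1 / of_real (1 - (cmod w)\<^sup>2) * (deriv \<phi> z * of_real (1 - (cmod z)\<^sup>2))"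
    by (rule DERIV_imp_deriv)
  then have "cmod (deriv g 0) = cmod (deriv \<phi> z) * (1 - (cmod z)\<^sup>2) / (1 - (cmod w)\<^sup>2)"
    using w2 z2 by (simp add: norm_mult norm_divide del: of_real_diff)
  then show ?thesis
    using le w2 by (simp add: w_def divide_le_eq)
qed

text \<open>By the maximum modulus principle a Schur function that reaches modulus 1 inside the disk
  is constant, and then its derivative vanishes; every other one falls under the strict
  case.\<close>

lemma Schwarz_Pick:
  assumes "\<phi> \<in> schur" and z: "cmod z < 1"
  shows "cmod (deriv \<phi> z) * (1 - (cmod z)\<^sup>2) \<le> 1 - (cmod (\<phi> z))\<^sup>2"
proof (cases "\<exists>\<xi>. cmod \<xi> < 1 \<and> cmod (\<phi> \<xi>) = 1")
  case True
  then obtain \<xi> where \<xi>: "cmod \<xi> < 1" "cmod (\<phi> \<xi>) = 1"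
    by blast
  have "\<phi> constant_on unit_disk"
    by (rule maximum_modulus_principle[of _ _ unit_disk \<xi>])
      (use assms \<xi> in \<open>auto simp: schur_def unit_disk_def\<close>)
  then obtain c where c: "\<And>z. z \<in> unit_disk \<Longrightarrow> \<phi> z = c"
    by (auto simp: constant_on_def)
  have "(\<phi> has_field_derivative 0) (at z)"
    by (rule has_field_derivative_transform_within_open[of "\<lambda>_. c" 0 z unit_disk])
      (use c z in auto)
  then have "deriv \<phi> z = 0"
    by (rule DERIV_imp_deriv)
  then show ?thesis
    using assms by (auto simp: schur_def abs_square_le_1)
next
  case False
  then show ?thesis
    using assms by (intro Schwarz_Pick_strict) (auto simp: schur_def order_less_le)
qed

section \<open>Schur functions parametrise the class\<close>

lemma one_plus_B_nonzero:
  assumes "\<phi> \<in> schur" "\<bar>B\<bar> \<le> 1" "cmod z < 1"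
  shows "1 + of_real B * z * \<phi> z \<noteq> 0"
proof -
  have "cmod (of_real B * \<phi> z) \<le> 1 * 1"
    unfolding norm_mult using assms by (intro mult_mono) (auto simp: schur_def)
  then show ?thesis
    using one_minus_mult_nonzero(2)[of "of_real B * \<phi> z" z] assms by (simp add: mult_ac)
qed

text \<open>The Schwarz lemma allows a factor \<open>z\<close> to be split off from the
  subordinating function, leaving \<open>\<phi>\<close> bounded by 1. Inserting
  \<open>\<omega> z = z * \<phi> z\<close> into the subordination gives the identity multiplied by
  \<open>z\<close>.\<close>

lemma class_C_schur:
  assumes f: "f \<in> class_C A B" and B: "\<bar>B\<bar> \<le> 1"
  shows "\<exists>\<phi>\<in>schur. \<forall>z\<in>unit_disk. deriv (deriv f) z / deriv f z
           = of_real (A - B) * \<phi> z / (1 + of_real B * z * \<phi> z)"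
proof -
  obtain \<omega> where hol: "\<omega> holomorphic_on unit_disk" and sub: "\<omega> ` unit_disk \<subseteq> unit_disk"
    and \<omega>0: "\<omega> 0 = 0"
    and eq: "\<And>z. z \<in> unit_disk \<Longrightarrow> 1 + z * deriv (deriv f) z / deriv f z
                = (1 + of_real A * \<omega> z) / (1 + of_real B * \<omega> z)"
    using f by (auto simp: class_C_def subordinate_def)
  have lt: "cmod (\<omega> z) < 1" if "cmod z < 1" for z
    using sub that by (metis image_subset_iff mem_unit_disk)
  obtain \<phi> where hol\<phi>: "\<phi> holomorphic_on ball 0 1"
    and \<omega>\<phi>: "\<And>z. cmod z < 1 \<Longrightarrow> \<omega> z = z * \<phi> z" and d0: "deriv \<omega> 0 = \<phi> 0"
    using Schwarz3[of \<omega> 1] hol \<omega>0 by (auto simp: unit_disk_def)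
  have "cmod (\<phi> z) \<le> 1" if "cmod z < 1" for z
  proof (cases "z = 0")
    case True
    then show ?thesis
      using Schwarz_Lemma(2)[of \<omega> 0] hol \<omega>0 lt d0 by (simp add: unit_disk_def)
  next
    case False
    have "cmod (z * \<phi> z) \<le> cmod z"
      using Schwarz_Lemma(1)[of \<omega> z] hol \<omega>0 lt \<omega>\<phi> that by (simp add: unit_disk_def)
    then show ?thesis
      using False by (simp add: norm_mult)
  qed
  then have \<phi>: "\<phi> \<in> schur"
    using hol\<phi> by (simp add: schur_def unit_disk_def)
  define P where "P = (\<lambda>z. deriv (deriv f) z / deriv f z)"
  define Q where "Q = (\<lambda>z. of_real (A - B) * \<phi> z / (1 + of_real B * z * \<phi> z))"
  have zPQ: "z * P z = z * Q z" if "z \<in> unit_disk" for z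
  proof -
    have "1 + z * P z = (1 + of_real A * (z * \<phi> z)) / (1 + of_real B * z * \<phi> z)"
      using eq[OF that] \<omega>\<phi> that by (simp add: P_def mult_ac)
    also have "\<dots> = 1 + z * Q z"
      using one_plus_B_nonzero[OF \<phi> B, of z] that by (simp add: Q_def field_simps)
    finally show ?thesis
      by simp
  qed
  have "f holomorphic_on unit_disk" "\<forall>z\<in>unit_disk. deriv f z \<noteq> 0"
    using f by (auto simp: class_C_def)
  then have "P holomorphic_on unit_disk"
    unfolding P_def by (intro holomorphic_intros) auto
  moreover have "Q holomorphic_on unit_disk"
    unfolding Q_def using \<phi> one_plus_B_nonzero[OF \<phi> B]
    by (intro holomorphic_intros) (auto simp: schur_def)
  \<comment> \<open>At \<open>z = 0\<close> the factor \<open>z\<close> cannot be cancelled. Instead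
    \<open>z * P z\<close> and \<open>z * Q z\<close> are differentiated at 0, which yields
    \<open>P 0\<close> and \<open>Q 0\<close>.\<close>
  ultimately have dP: "(P has_field_derivative deriv P 0) (at 0)"
    and dQ: "(Q has_field_derivative deriv Q 0) (at 0)"
    by (auto intro!: holomorphic_derivI[of _ unit_disk])
  have "((\<lambda>z. z * P z) has_field_derivative P 0) (at 0)"
    using dP by (auto intro!: derivative_eq_intros)
  moreover have "((\<lambda>z. z * P z) has_field_derivative Q 0) (at 0)"
    by (rule has_field_derivative_transform_within_open[of "\<lambda>z. z * Q z" _ _ unit_disk])
      (use dQ zPQ[symmetric] in \<open>auto intro!: derivative_eq_intros simp del: mult_cancel_left\<close>)
  ultimately have "P 0 = Q 0"
    by (rule DERIV_unique)
  then have "P z = Q z" if "z \<in> unit_disk" for z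
    using zPQ[OF that] by (cases "z = 0") auto
  then show ?thesis
    using \<phi> by (auto simp: P_def Q_def)
qed

text \<open>Two integrations recover \<open>f\<close>: the exponential of a primitive of
  \<open>Q\<close> serves as \<open>f'\<close>, which makes it zero-free, and a primitive of that is
  \<open>f\<close>. The constants are fixed by \<open>f 0 = 0\<close> and
  \<open>deriv f 0 = 1\<close>.\<close>

lemma schur_class_C:
  assumes \<phi>: "\<phi> \<in> schur" and B: "\<bar>B\<bar> \<le> 1"
  shows "\<exists>f\<in>class_C A B. \<forall>z\<in>unit_disk. deriv (deriv f) z / deriv f z
           = of_real (A - B) * \<phi> z / (1 + of_real B * z * \<phi> z)"
proof -
  define Q where "Q = (\<lambda>z. of_real (A - B) * \<phi> z / (1 + of_real B * z * \<phi> z))"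
  have cvx: "convex unit_disk"
    by (simp add: unit_disk_def)
  have "Q holomorphic_on unit_disk"
    unfolding Q_def using \<phi> one_plus_B_nonzero[OF \<phi> B]
    by (intro holomorphic_intros) (auto simp: schur_def)
  then obtain g0 where "\<And>z. z \<in> unit_disk \<Longrightarrow> (g0 has_field_derivative Q z) (at z within unit_disk)"
    using holomorphic_convex_primitive'[OF cvx open_unit_disk] by metis
  then have g0: "(g0 has_field_derivative Q z) (at z)" if "cmod z < 1" for z
    using that at_within_open[of z unit_disk] by (metis mem_unit_disk open_unit_disk)
  define g where "g = (\<lambda>z. exp (g0 z - g0 0))"
  have g: "(g has_field_derivative g z * Q z) (at z)" if "cmod z < 1" for z
    unfolding g_def using g0[OF that] by (auto intro!: derivative_eq_intros)
  then have "g holomorphic_on unit_disk"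
    by (auto simp: holomorphic_on_open intro!: exI)
  then obtain f0 where "\<And>z. z \<in> unit_disk \<Longrightarrow> (f0 has_field_derivative g z) (at z within unit_disk)"
    using holomorphic_convex_primitive'[OF cvx open_unit_disk] by metis
  then have f0: "(f0 has_field_derivative g z) (at z)" if "cmod z < 1" for z
    using that at_within_open[of z unit_disk] by (metis mem_unit_disk open_unit_disk)
  define f where "f = (\<lambda>z. f0 z - f0 0)"
  have f: "(f has_field_derivative g z) (at z)" if "cmod z < 1" for z
    unfolding f_def using f0[OF that] by (auto intro!: derivative_eq_intros)
  have df: "deriv f z = g z" if "cmod z < 1" for z
    using f[OF that] by (rule DERIV_imp_deriv)
  have ddf: "deriv (deriv f) z = g z * Q z" if "cmod z < 1" for z
    by (intro DERIV_imp_deriv has_field_derivative_transform_within_open[OF g[OF that], of unit_disk])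
      (use df that in auto)
  have gnz: "g z \<noteq> 0" for z
    by (simp add: g_def)
  have PQ: "deriv (deriv f) z / deriv f z = Q z" if "cmod z < 1" for z
    using that by (simp add: df ddf gnz)
  have "f holomorphic_on unit_disk"
    using f by (auto simp: holomorphic_on_open intro!: exI)
  moreover have "f 0 = 0" "deriv f 0 = 1"
    by (simp_all add: f_def[THEN fun_cong] df g_def)
  moreover have "\<forall>z\<in>unit_disk. deriv f z \<noteq> 0"
    by (simp add: df gnz)
  moreover have "subordinate (\<lambda>z. 1 + z * deriv (deriv f) z / deriv f z)
                   (\<lambda>z. (1 + of_real A * z) / (1 + of_real B * z))"
    unfolding subordinate_def
  proof (intro exI[of _ "\<lambda>z. z * \<phi> z"] conjI ballI)
    show "(\<lambda>z. z * \<phi> z) holomorphic_on unit_disk"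
      using \<phi> by (intro holomorphic_intros) (simp add: schur_def)
    have "cmod (z * \<phi> z) < 1" if "cmod z < 1" for z
      using mult_left_mono[of "cmod (\<phi> z)" 1 "cmod z"] \<phi> that by (auto simp: schur_def norm_mult)
    then show "(\<lambda>z. z * \<phi> z) ` unit_disk \<subseteq> unit_disk"
      by auto
    fix z :: complex assume z: "z \<in> unit_disk"
    have "1 + z * deriv (deriv f) z / deriv f z = 1 + z * Q z"
      using PQ[of z] z by (metis mem_unit_disk times_divide_eq_right)
    also have "\<dots> = (1 + of_real A * (z * \<phi> z)) / (1 + of_real B * (z * \<phi> z))"
      using one_plus_B_nonzero[OF \<phi> B, of z] z by (simp add: Q_def field_simps)
    finally show "1 + z * deriv (deriv f) z / deriv f z = \<dots>" .
  qed simp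
  ultimately have "f \<in> class_C A B"
    by (simp add: class_C_def)
  then show ?thesis
    using PQ unfolding Q_def by (metis mem_unit_disk)
qed

text \<open>In the quotient rule the terms with \<open>z * \<phi> * \<phi>'\<close> cancel, leaving
  \<open>\<phi>' - B \<phi>^2\<close> in the numerator. Subtracting half the square of the quotient
  changes the coefficient \<open>B\<close> to \<open>B + (A - B) / 2 = (A + B) / 2\<close>.\<close>

lemma schwarzian_schur:
  assumes \<phi>: "\<phi> \<in> schur" and B: "\<bar>B\<bar> \<le> 1" and z: "cmod z < 1"
    and P: "\<forall>z\<in>unit_disk. deriv (deriv f) z / deriv f z
           = of_real (A - B) * \<phi> z / (1 + of_real B * z * \<phi> z)"
  shows "schwarzian f z = of_real (A - B) * (deriv \<phi> z - of_real ((A + B) / 2) * (\<phi> z)\<^sup>2)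
           / (1 + of_real B * z * \<phi> z)\<^sup>2"
proof -
  note nz = one_plus_B_nonzero[OF \<phi> B z]
  have d: "(\<phi> has_field_derivative deriv \<phi> z) (at z)"
    using \<phi> z by (intro holomorphic_derivI[of _ unit_disk]) (auto simp: schur_def)
  have "((\<lambda>z. of_real (A - B) * \<phi> z / (1 + of_real B * z * \<phi> z)) has_field_derivative
      of_real (A - B) * (deriv \<phi> z - of_real B * (\<phi> z)\<^sup>2) / (1 + of_real B * z * \<phi> z)\<^sup>2) (at z)"
    by (rule derivative_eq_intros d refl nz)+
      (simp add: power2_eq_square algebra_simps)
  then have "((\<lambda>z. deriv (deriv f) z / deriv f z) has_field_derivative
      of_real (A - B) * (deriv \<phi> z - of_real B * (\<phi> z)\<^sup>2) / (1 + of_real B * z * \<phi> z)\<^sup>2) (at z)"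
    by (rule has_field_derivative_transform_within_open[of _ _ _ unit_disk]) (use P z in auto)
  then have "schwarzian f z =
      of_real (A - B) * (deriv \<phi> z - of_real B * (\<phi> z)\<^sup>2) / (1 + of_real B * z * \<phi> z)\<^sup>2
      - (1/2) * (of_real (A - B) * \<phi> z / (1 + of_real B * z * \<phi> z))\<^sup>2"
    unfolding schwarzian_def using P z by (simp add: DERIV_imp_deriv)
  also have "\<dots> = of_real (A - B) * (deriv \<phi> z - of_real ((A + B) / 2) * (\<phi> z)\<^sup>2)
           / (1 + of_real B * z * \<phi> z)\<^sup>2"
  proof -
    have "a * (d - b * p\<^sup>2) / K\<^sup>2 - (1/2) * (a * p / K)\<^sup>2 = a * (d - (b + a / 2) * p\<^sup>2) / K\<^sup>2"
      if "K \<noteq> 0" for a b d p K :: complex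
      using that by (simp add: field_simps power2_eq_square)
    moreover have "complex_of_real B + of_real (A - B) / 2 = of_real ((A + B) / 2)"
      by (simp add: field_simps)
    ultimately show ?thesis
      using nz by metis
  qed
  finally show ?thesis .
qed

section \<open>The two-variable majorant\<close>

definition pick_bound :: "real \<Rightarrow> real \<Rightarrow> real \<Rightarrow> real \<Rightarrow> real" where
  "pick_bound c b r s = (1 - r\<^sup>2) * (1 - s\<^sup>2 + c / 2 * (1 - r\<^sup>2) * s\<^sup>2) / (1 - b * r * s)\<^sup>2"

text \<open>The triangle inequality is applied to numerator and denominator separately. One of the
  two factors \<open>1 - r^2\<close> of the weight is spent on Schwarz-Pick for
  \<open>\<phi>'\<close>; the other remains in front.\<close>

lemma schwarzian_le_pick_bound:
  assumes \<phi>: "\<phi> \<in> schur" and B: "\<bar>B\<bar> \<le> 1" and BA: "B < A" and z: "cmod z < 1"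
  shows "(1 - (cmod z)\<^sup>2)\<^sup>2 * cmod (of_real (A - B) * (deriv \<phi> z - of_real ((A + B) / 2) * (\<phi> z)\<^sup>2)
           / (1 + of_real B * z * \<phi> z)\<^sup>2) \<le> (A - B) * pick_bound \<bar>A + B\<bar> \<bar>B\<bar> (cmod z) (cmod (\<phi> z))"
proof -
  define r s u c b where "r = cmod z" and "s = cmod (\<phi> z)" and "u = 1 - r\<^sup>2"
    and "c = \<bar>A + B\<bar>" and "b = \<bar>B\<bar>"
  have r: "0 \<le> r" "r < 1" and s: "0 \<le> s" "s \<le> 1" and b: "0 \<le> b" "b \<le> 1"
    using \<phi> z B by (auto simp: r_def s_def b_def schur_def)
  have u: "0 < u"
    using r by (simp add: u_def abs_square_less_1)
  have "b * s \<le> 1"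
    using b s by (simp add: mult_le_one)
  then have "b * s * r \<le> 1 * r"
    using r by (intro mult_right_mono) auto
  then have pos: "0 < 1 - b * r * s"
    using r by (simp add: mult_ac)
  have "cmod (of_real B * z * \<phi> z) = b * r * s"
    by (simp add: norm_mult b_def r_def s_def)
  then have den: "1 - b * r * s \<le> cmod (1 + of_real B * z * \<phi> z)"
    using norm_diff_ineq[of 1 "of_real B * z * \<phi> z"] by simp
  have "cmod (of_real ((A + B) / 2) * (\<phi> z)\<^sup>2) = c / 2 * s\<^sup>2"
    by (simp only: norm_mult norm_of_real norm_power c_def s_def abs_divide abs_numeral)
  then have "cmod (deriv \<phi> z - of_real ((A + B) / 2) * (\<phi> z)\<^sup>2) \<le> cmod (deriv \<phi> z) + c / 2 * s\<^sup>2"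
    using norm_triangle_ineq4[of "deriv \<phi> z" "of_real ((A + B) / 2) * (\<phi> z)\<^sup>2"] by simp
  then have "u * cmod (deriv \<phi> z - of_real ((A + B) / 2) * (\<phi> z)\<^sup>2)
      \<le> u * (cmod (deriv \<phi> z) + c / 2 * s\<^sup>2)"
    using u by (intro mult_left_mono) auto
  also have "\<dots> \<le> 1 - s\<^sup>2 + c / 2 * u * s\<^sup>2"
  proof -
    have "cmod (deriv \<phi> z) * u \<le> 1 - s\<^sup>2"
      using Schwarz_Pick[OF \<phi> z] by (simp add: r_def s_def u_def)
    then show ?thesis
      by (simp add: algebra_simps)
  qed
  finally have num: "u * cmod (deriv \<phi> z - of_real ((A + B) / 2) * (\<phi> z)\<^sup>2)
      \<le> 1 - s\<^sup>2 + c / 2 * u * s\<^sup>2" .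
  have "u\<^sup>2 * cmod (of_real (A - B) * (deriv \<phi> z - of_real ((A + B) / 2) * (\<phi> z)\<^sup>2)
           / (1 + of_real B * z * \<phi> z)\<^sup>2)
      = (A - B) * (u * (u * cmod (deriv \<phi> z - of_real ((A + B) / 2) * (\<phi> z)\<^sup>2))
           / (cmod (1 + of_real B * z * \<phi> z))\<^sup>2)"
    using BA by (simp only: norm_mult norm_divide norm_power norm_of_real) (simp add: power2_eq_square)
  also have "\<dots> \<le> (A - B) * (u * (1 - s\<^sup>2 + c / 2 * u * s\<^sup>2) / (1 - b * r * s)\<^sup>2)"
    using BA u num den pos
    by (intro mult_left_mono frac_le power_mono mult_nonneg_nonneg order_trans[OF _ num]) auto
  finally show ?thesis
    by (simp add: pick_bound_def r_def s_def u_def c_def b_def)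
qed

lemma schwarzian_norm_le:
  assumes f: "f \<in> class_C A B" and B: "\<bar>B\<bar> \<le> 1" and BA: "B < A"
    and M: "\<And>r s. 0 \<le> r \<Longrightarrow> r < 1 \<Longrightarrow> 0 \<le> s \<Longrightarrow> s \<le> 1 \<Longrightarrow>
              (A - B) * pick_bound \<bar>A + B\<bar> \<bar>B\<bar> r s \<le> M"
  shows "schwarzian_norm f \<le> ereal M"
proof -
  obtain \<phi> where \<phi>: "\<phi> \<in> schur" and P: "\<forall>z\<in>unit_disk. deriv (deriv f) z / deriv f z
           = of_real (A - B) * \<phi> z / (1 + of_real B * z * \<phi> z)"
    using class_C_schur[OF f B] by blast
  have "(1 - (cmod z)\<^sup>2)\<^sup>2 * cmod (schwarzian f z) \<le> M" if z: "cmod z < 1" for z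
  proof -
    have "cmod (\<phi> z) \<le> 1"
      using \<phi> z by (simp add: schur_def)
    then show ?thesis
      unfolding schwarzian_schur[OF \<phi> B z P]
      using schwarzian_le_pick_bound[OF \<phi> B BA z] M[of "cmod z" "cmod (\<phi> z)"] z by simp
  qed
  then show ?thesis
    unfolding schwarzian_norm_def by (intro SUP_least) simp
qed

text \<open>Each value of the weighted Schwarzian bounds the norm from below, and so does their
  limit. Sequences are used because for \<open>B = -1\<close> the points run to the boundary; a
  constant sequence covers an interior maximum. Real data make the modulus explicit.\<close>

lemma schwarzian_norm_attained:
  fixes x y d :: "nat \<Rightarrow> real"
  assumes le: "\<And>f. f \<in> class_C A B \<Longrightarrow> schwarzian_norm f \<le> ereal M"
    and \<phi>: "\<phi> \<in> schur" and B: "\<bar>B\<bar> \<le> 1" and BA: "B < A"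
    and x: "\<And>n. \<bar>x n\<bar> < 1" and y: "\<And>n. \<phi> (of_real (x n)) = of_real (y n)"
    and d: "\<And>n. deriv \<phi> (of_real (x n)) = of_real (d n)"
    and lim: "(\<lambda>n. (1 - (x n)\<^sup>2)\<^sup>2 * ((A - B) * \<bar>d n - (A + B) / 2 * (y n)\<^sup>2\<bar>
                 / (1 + B * x n * y n)\<^sup>2)) \<longlonglongrightarrow> M"
  shows "\<exists>f\<in>class_C A B. schwarzian_norm f = ereal M"
proof -
  obtain f where f: "f \<in> class_C A B" and P: "\<forall>z\<in>unit_disk. deriv (deriv f) z / deriv f z
           = of_real (A - B) * \<phi> z / (1 + of_real B * z * \<phi> z)"
    using schur_class_C[OF \<phi> B] by blast
  have "ereal ((1 - (x n)\<^sup>2)\<^sup>2 * ((A - B) * \<bar>d n - (A + B) / 2 * (y n)\<^sup>2\<bar>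
                 / (1 + B * x n * y n)\<^sup>2)) \<le> schwarzian_norm f" for n
  proof -
    have xn: "cmod (of_real (x n)) < 1"
      using x by simp
    have "schwarzian f (of_real (x n))
        = of_real ((A - B) * (d n - (A + B) / 2 * (y n)\<^sup>2) / (1 + B * x n * y n)\<^sup>2)"
      unfolding schwarzian_schur[OF \<phi> B xn P] y d by simp
    then have "cmod (schwarzian f (of_real (x n)))
        = (A - B) * \<bar>d n - (A + B) / 2 * (y n)\<^sup>2\<bar> / (1 + B * x n * y n)\<^sup>2"
      using BA by (simp only: norm_of_real abs_mult abs_divide) simp
    then show ?thesis
      unfolding schwarzian_norm_def
      by (intro SUP_upper2[of "of_real (x n)"]) (use x in auto)
  qed
  then have "ereal M \<le> schwarzian_norm f"
    by (intro LIMSEQ_le_const2[OF tendsto_ereal[OF lim]]) auto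
  then show ?thesis
    using f le[OF f] by (intro bexI[of _ f] antisym)
qed

section \<open>Extremal Schur functions\<close>

lemma real_Moebius:
  fixes p \<eta> :: real
  assumes p: "\<bar>p\<bar> \<le> 1" and \<eta>: "\<bar>\<eta>\<bar> = 1"
  defines "\<phi> \<equiv> \<lambda>z. of_real \<eta> * (z - of_real p) / (1 - of_real p * z)"
  shows "\<phi> \<in> schur"
    and "\<phi> (of_real x) = of_real (\<eta> * (x - p) / (1 - p * x))"
    and "\<bar>x\<bar> < 1 \<Longrightarrow> deriv \<phi> (of_real x) = of_real (\<eta> * (1 - p\<^sup>2) / (1 - p * x)\<^sup>2)"
proof -
  have nz: "1 - of_real p * z \<noteq> 0" if "cmod z < 1" for z
    using one_minus_mult_nonzero(1)[of "of_real p" z] p that by simp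
  have "cmod (\<phi> z) \<le> 1" if "cmod z < 1" for z
  proof -
    \<comment> \<open>This identity also covers \<open>p = 1\<close> and \<open>p = -1\<close>,
      where the map degenerates to a constant; \<open>p = -1\<close> arises below for
      \<open>A = 0\<close>, \<open>B = -1\<close>.\<close>
    have "(cmod (1 - of_real p * z))\<^sup>2 - (cmod (z - of_real p))\<^sup>2 = (1 - p\<^sup>2) * (1 - (cmod z)\<^sup>2)"
      unfolding cmod_power2 by simp (simp add: power2_eq_square algebra_simps)
    also have "\<dots> \<ge> 0"
      using p that by (simp add: abs_square_le_1)
    finally have "cmod (z - of_real p) \<le> cmod (1 - of_real p * z)"
      by (intro power2_le_imp_le[OF _ norm_ge_zero]) linarith
    then show ?thesis
      using nz[OF that] \<eta> by (simp add: \<phi>_def norm_mult norm_divide)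
  qed
  moreover have "\<phi> holomorphic_on unit_disk"
    unfolding \<phi>_def using nz by (intro holomorphic_intros) auto
  ultimately show "\<phi> \<in> schur"
    by (simp add: schur_def)
  show "\<phi> (of_real x) = of_real (\<eta> * (x - p) / (1 - p * x))"
    by (simp add: \<phi>_def)
  assume x: "\<bar>x\<bar> < 1"
  have "(\<phi> has_field_derivative of_real \<eta> * (1 - (of_real p)\<^sup>2) / (1 - of_real p * z)\<^sup>2) (at z)"
    if "1 - of_real p * z \<noteq> 0" for z
    unfolding \<phi>_def
    by (rule derivative_eq_intros refl that)+ (simp add: power2_eq_square algebra_simps)
  from this[of "of_real x"] show "deriv \<phi> (of_real x) = of_real (\<eta> * (1 - p\<^sup>2) / (1 - p * x)\<^sup>2)"
    using nz[of "of_real x"] x by (simp add: DERIV_imp_deriv)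
qed

text \<open>Disk automorphisms give equality in Schwarz-Pick, and the real ones are flexible enough
  to prescribe the value at \<open>x\<close> together with the sign \<open>\<eta>\<close> of the
  derivative there.\<close>

lemma Schwarz_Pick_equality:
  fixes x \<sigma> \<eta> :: real
  assumes x: "\<bar>x\<bar> < 1" and \<sigma>: "\<bar>\<sigma>\<bar> < 1" and \<eta>: "\<bar>\<eta>\<bar> = 1"
  obtains \<phi> where "\<phi> \<in> schur" "\<phi> (of_real x) = of_real \<sigma>"
    "deriv \<phi> (of_real x) = of_real (\<eta> * (1 - \<sigma>\<^sup>2) / (1 - x\<^sup>2))"
proof -
  \<comment> \<open>Since \<open>\<eta>^2 = 1\<close>, this is the value that
    \<open>(z - p) / (1 - p z)\<close> must take at \<open>x\<close>; the \<open>p\<close> chosen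
    below solves that equation.\<close>
  define \<tau> where "\<tau> = \<eta> * \<sigma>"
  have \<tau>: "\<bar>\<tau>\<bar> < 1" and \<tau>2: "\<tau>\<^sup>2 = \<sigma>\<^sup>2" and \<eta>\<tau>: "\<eta> * \<tau> = \<sigma>"
    using \<eta> \<sigma> by (auto simp: \<tau>_def abs_if split: if_splits)
  have x2: "x\<^sup>2 < 1" and t2: "\<tau>\<^sup>2 < 1"
    using x \<tau> by (auto simp: abs_square_less_1)
  have "\<bar>x * \<tau>\<bar> < 1"
    using mult_strict_mono[of "\<bar>x\<bar>" 1 "\<bar>\<tau>\<bar>" 1] x \<tau> by (simp add: abs_mult)
  then have K: "0 < 1 - x * \<tau>"
    by linarith
  define p where "p = (x - \<tau>) / (1 - x * \<tau>)"
  have p1: "x - p = \<tau> * (1 - x\<^sup>2) / (1 - x * \<tau>)" and p2: "1 - p * x = (1 - x\<^sup>2) / (1 - x * \<tau>)"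
    unfolding p_def using K by (simp_all add: field_simps power2_eq_square)
  have "(1 - x * \<tau>)\<^sup>2 - (x - \<tau>)\<^sup>2 = (1 - x\<^sup>2) * (1 - \<tau>\<^sup>2)"
    by algebra
  then have p3: "1 - p\<^sup>2 = (1 - x\<^sup>2) * (1 - \<tau>\<^sup>2) / (1 - x * \<tau>)\<^sup>2"
    unfolding p_def power_divide using K by (simp add: diff_divide_eq_iff eq_divide_eq divide_diff_eq_iff)
  have "0 \<le> 1 - p\<^sup>2"
    unfolding p3 using x2 t2 by simp
  then have p: "\<bar>p\<bar> \<le> 1"
    by (simp add: abs_square_le_1)
  have v: "(x - p) / (1 - p * x) = \<tau>"
    unfolding p1 p2 using K x2 by simp
  have D: "(1 - p\<^sup>2) / (1 - p * x)\<^sup>2 = (1 - \<tau>\<^sup>2) / (1 - x\<^sup>2)"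
    unfolding p2 p3 using K x2 by (simp add: power_divide) (simp add: power2_eq_square)
  show ?thesis
  proof (rule that[OF real_Moebius(1)[OF p \<eta>]])
    have "\<eta> * (x - p) / (1 - p * x) = \<sigma>"
      using v \<eta>\<tau> by (simp flip: times_divide_eq_right)
    then show "of_real \<eta> * (of_real x - of_real p) / (1 - of_real p * of_real x) = complex_of_real \<sigma>"
      using real_Moebius(2)[OF p \<eta>, of x] by (simp only:)
    have "\<eta> * (1 - p\<^sup>2) / (1 - p * x)\<^sup>2 = \<eta> * (1 - \<sigma>\<^sup>2) / (1 - x\<^sup>2)"
      using D \<tau>2 by (simp flip: times_divide_eq_right)
    then show "deriv (\<lambda>z. of_real \<eta> * (z - of_real p) / (1 - of_real p * z)) (of_real x)
        = complex_of_real (\<eta> * (1 - \<sigma>\<^sup>2) / (1 - x\<^sup>2))"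
      using real_Moebius(3)[OF p \<eta> x] by (simp only:)
  qed
qed

section \<open>Maximising the majorant\<close>

text \<open>The expression is affine in \<open>x\<close>, with values \<open>2 - c\<close> at 0 and
  \<open>2 (1 - b^2)\<close> at 1; it is their convex combination with positive weight on the first.
  It is used with \<open>x = r^2\<close>.\<close>

lemma gamma_denominator_pos:
  fixes c b x :: real
  assumes "c < 2" "b\<^sup>2 \<le> 1" "0 \<le> x" "x < 1"
  shows "0 < 2 - c * (1 - x) - 2 * b\<^sup>2 * x"
proof -
  have "0 < (2 - c) * (1 - x)" "0 \<le> 2 * (1 - b\<^sup>2) * x"
    using assms by simp_all
  then show ?thesis
    by (simp add: algebra_simps)
qed

lemma pick_bound_le_gamma_fun:
  assumes c: "\<bar>A + B\<bar> < 2" and B: "\<bar>B\<bar> \<le> 1" and r: "0 \<le> r" "r < 1" and s: "0 \<le> s" "s \<le> 1"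
  shows "pick_bound \<bar>A + B\<bar> \<bar>B\<bar> r s \<le> gamma_fun A B r"
proof -
  define c b k where "c = \<bar>A + B\<bar>" and "b = \<bar>B\<bar>" and "k = 1 - c / 2 * (1 - r\<^sup>2)"
  have r2: "r\<^sup>2 < 1"
    using r by (simp add: abs_square_less_1)
  have D: "0 < k - b\<^sup>2 * r\<^sup>2"
    using gamma_denominator_pos[of c b "r\<^sup>2"] c B r2 by (simp add: c_def b_def k_def abs_square_le_1 field_simps)
  have "b * s \<le> 1"
    using B s by (simp add: mult_le_one b_def)
  then have "b * s * r \<le> 1 * r"
    using r by (intro mult_right_mono) auto
  then have pos: "0 < 1 - b * r * s"
    using r by (simp add: mult_ac)
  \<comment> \<open>After cross-multiplication the two sides differ by a square that vanishes
    exactly at the maximiser \<open>s = b r / k\<close>, so no derivative in \<open>s\<close> is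
    taken.\<close>
  have "k * (1 - b * r * s)\<^sup>2 - (1 - k * s\<^sup>2) * (k - b\<^sup>2 * r\<^sup>2) = (b * r - k * s)\<^sup>2"
    by (simp add: power2_eq_square algebra_simps)
  then have "(1 - k * s\<^sup>2) * (k - b\<^sup>2 * r\<^sup>2) \<le> k * (1 - b * r * s)\<^sup>2"
    by (smt (verit) zero_le_power2)
  then have "(1 - k * s\<^sup>2) / (1 - b * r * s)\<^sup>2 \<le> k / (k - b\<^sup>2 * r\<^sup>2)"
    using D pos by (simp add: divide_le_eq le_divide_eq)
  then have "(1 - r\<^sup>2) * ((1 - k * s\<^sup>2) / (1 - b * r * s)\<^sup>2) \<le> (1 - r\<^sup>2) * (k / (k - b\<^sup>2 * r\<^sup>2))"
    using r2 by (intro mult_left_mono) auto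
  also have "k / (k - b\<^sup>2 * r\<^sup>2) = (2 * k) / (2 * (k - b\<^sup>2 * r\<^sup>2))"
    by (rule mult_divide_mult_cancel_left[symmetric]) simp
  finally have le: "(1 - r\<^sup>2) * (1 - k * s\<^sup>2) / (1 - b * r * s)\<^sup>2
      \<le> (1 - r\<^sup>2) * (2 * k) / (2 * (k - b\<^sup>2 * r\<^sup>2))"
    by simp
  have eq: "1 - k * s\<^sup>2 = 1 - s\<^sup>2 + c / 2 * (1 - r\<^sup>2) * s\<^sup>2" "2 * k = 2 - c * (1 - r\<^sup>2)"
    "2 * (k - b\<^sup>2 * r\<^sup>2) = 2 - c * (1 - r\<^sup>2) - 2 * B\<^sup>2 * r\<^sup>2"
    by (simp_all add: k_def b_def algebra_simps)
  show ?thesis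
    using le unfolding eq by (simp only: pick_bound_def gamma_fun_def c_def b_def)
qed

lemma gamma_fun_le_1:
  assumes c: "\<bar>A + B\<bar> < 2" and B: "\<bar>B\<bar> \<le> 1" and r: "0 \<le> r" "r < 1"
    and small: "\<bar>A + B\<bar> \<le> 2 * (1 - B\<^sup>2)"
  shows "gamma_fun A B r \<le> 1"
proof -
  have r2: "r\<^sup>2 < 1"
    using r by (simp add: abs_square_less_1)
  have D: "0 < 2 - \<bar>A + B\<bar> * (1 - r\<^sup>2) - 2 * B\<^sup>2 * r\<^sup>2"
    using gamma_denominator_pos[of "\<bar>A + B\<bar>" B "r\<^sup>2"] c B r2 by (simp add: abs_square_le_1)
  \<comment> \<open>The right-hand side is the denominator of \<open>\<gamma>\<close> minus its
    numerator.\<close>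
  have "0 \<le> (2 * (1 - B\<^sup>2) - \<bar>A + B\<bar>) * r\<^sup>2 + \<bar>A + B\<bar> * (r\<^sup>2)\<^sup>2"
    using small by (intro add_nonneg_nonneg mult_nonneg_nonneg) auto
  then have "(1 - r\<^sup>2) * (2 - \<bar>A + B\<bar> * (1 - r\<^sup>2)) \<le> 2 - \<bar>A + B\<bar> * (1 - r\<^sup>2) - 2 * B\<^sup>2 * r\<^sup>2"
    by (simp add: algebra_simps power2_eq_square)
  then show ?thesis
    using D by (simp add: gamma_fun_def)
qed

text \<open>With \<open>x = r\<^sup>2\<close>, \<open>\<gamma> = N / D\<close> for a quadratic \<open>N\<close> with leading coefficient
  \<open>- \<bar>A + B\<bar>\<close> and a linear \<open>D\<close>, and \<open>h = N' D - N D'\<close>; hence at a zero \<open>x\<^sub>0\<close> of \<open>h\<close> the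
  quadratic \<open>N - \<gamma>(x\<^sub>0) D\<close> has a double zero.\<close>

lemma gamma_fun_le_critical:
  assumes c: "\<bar>A + B\<bar> < 2" and B: "\<bar>B\<bar> \<le> 1" and r: "0 \<le> r" "r < 1"
    and t: "0 < t" "t < 1" and h: "h_poly A B t = 0"
  shows "gamma_fun A B r \<le> gamma_fun A B t"
proof -
  define c where "c = \<bar>A + B\<bar>"
  define N where "N = (\<lambda>x. (1 - x) * (2 - c * (1 - x)))"
  define D where "D = (\<lambda>x. 2 - c * (1 - x) - 2 * B\<^sup>2 * x)"
  define x y where "x = r\<^sup>2" and "y = t\<^sup>2"
  have "B\<^sup>2 \<le> 1" "x < 1" "y < 1"
    using r t B by (auto simp: abs_square_less_1 abs_square_le_1 x_def y_def)
  then have Dx: "0 < D x" and Dy: "0 < D y"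
    using gamma_denominator_pos[of c B] c by (auto simp: D_def c_def x_def y_def)
  have "(2 - c) * (c + 2 * B\<^sup>2 - 2) - 2 * c * (2 - c) * y + c * (2 * B\<^sup>2 - c) * (y * y) = 0"
    using h by (simp add: h_poly_def c_def y_def flip: power_add)
  then have "N x * D y - N y * D x = - c * (x - y)\<^sup>2 * D y"
    unfolding N_def D_def by algebra
  also have "\<dots> \<le> 0"
    using Dy by (simp add: c_def mult_nonneg_nonneg)
  finally have "N x / D x \<le> N y / D y"
    using Dx Dy by (simp add: divide_le_eq le_divide_eq field_simps)
  then show ?thesis
    by (simp add: gamma_fun_def N_def D_def x_def y_def c_def)
qed

text \<open>Existence comes from a sign change: \<open>h\<close> is positive at 0 because
  \<open>c\<close> is large but below 2, and equals \<open>-4 (1 - B^2)\<close> at 1. Uniqueness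
  comes from strict decrease: \<open>h(u) - h(v)\<close> is \<open>c (v^2 - u^2)\<close> times the
  sum of the denominators of \<open>\<gamma>\<close> at \<open>u\<close> and
  \<open>v\<close>.\<close>

lemma h_poly_unique_root:
  assumes B: "\<bar>B\<bar> < 1" and c: "\<bar>A + B\<bar> < 2" and large: "2 * (1 - B\<^sup>2) < \<bar>A + B\<bar>"
  shows "\<exists>!t. 0 < t \<and> t < 1 \<and> h_poly A B t = 0"
proof -
  define c where "c = \<bar>A + B\<bar>"
  have b2: "B\<^sup>2 < 1"
    using B by (simp add: abs_square_less_1)
  have c0: "0 < c"
    using large b2 by (simp add: c_def)
  have "h_poly A B 1 = - 4 * (1 - B\<^sup>2)"
    by (simp add: h_poly_def algebra_simps)
  then have h1: "h_poly A B 1 < 0"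
    using b2 by simp
  have h0: "0 < h_poly A B 0"
    using large c by (simp add: h_poly_def)
  have "continuous_on {0..1} (h_poly A B)"
    unfolding h_poly_def by (intro continuous_intros)
  then obtain t where t: "0 \<le> t" "t \<le> 1" "h_poly A B t = 0"
    using IVT2'[of "h_poly A B" 1 0 0] h0 h1 by auto
  then have "0 < t \<and> t < 1 \<and> h_poly A B t = 0"
    using h0 h1 by (auto simp: order_less_le)
  moreover have decr: "h_poly A B v < h_poly A B u" if "0 < u" "u < v" "v < 1" for u v
  proof -
    have uv: "u\<^sup>2 < v\<^sup>2" "v\<^sup>2 < 1"
      using that by (auto simp: power_strict_mono abs_square_less_1)
    have "0 < 2 - c * (1 - u\<^sup>2) - 2 * B\<^sup>2 * u\<^sup>2" "0 < 2 - c * (1 - v\<^sup>2) - 2 * B\<^sup>2 * v\<^sup>2"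
      using gamma_denominator_pos[of c B] c b2 uv by (auto simp: c_def)
    then have "0 < c * (v\<^sup>2 - u\<^sup>2) * ((2 - c * (1 - u\<^sup>2) - 2 * B\<^sup>2 * u\<^sup>2) + (2 - c * (1 - v\<^sup>2) - 2 * B\<^sup>2 * v\<^sup>2))"
      using c0 uv by (intro mult_pos_pos add_pos_pos) auto
    also have "\<dots> = h_poly A B u - h_poly A B v"
      unfolding h_poly_def c_def[symmetric] by algebra
    finally show ?thesis
      by simp
  qed
  ultimately show ?thesis
    by (smt (verit))
qed

text \<open>For \<open>c \<ge> 2 m\<close> the bound reduces to its boundary case \<open>c = 2 m\<close>, which says that a
  quadratic in \<open>s\<close> has nonpositive discriminant.\<close>

lemma pick_bound_le_E3:
  fixes b c m r s :: real
  assumes m: "1/2 \<le> m" "m \<le> 1" and b: "0 \<le> b" "b \<le> 1" "b\<^sup>2 = 4 * m * (1 - m)"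
    and c: "2 * m \<le> c" and r: "0 \<le> r" "r < 1" and s: "0 \<le> s" "s \<le> 1"
  shows "pick_bound c b r s \<le> c / (2 * m\<^sup>2)"
proof -
  define u where "u = 1 - r\<^sup>2"
  have "r\<^sup>2 < 1"
    using r by (simp add: abs_square_less_1)
  then have u: "0 < u" "u \<le> 1"
    by (simp_all add: u_def)
  define k where "k = 1 - m * u"
  have k: "0 \<le> k" "k \<le> 1"
    using m u by (auto simp: k_def mult_le_one)
  \<comment> \<open>The relation between \<open>b\<close> and \<open>m\<close> turns the
    discriminant condition into a perfect square.\<close>
  have "k\<^sup>2 - (b * r)\<^sup>2 = (1 - m - m * r\<^sup>2)\<^sup>2"
    using b(3) by (simp add: k_def u_def power_mult_distrib) (simp add: power2_eq_square algebra_simps)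
  then have brk: "(b * r)\<^sup>2 \<le> k\<^sup>2"
    by (smt (verit) zero_le_power2)
  have ks: "b * r \<le> k"
    using brk k(1) by (rule power2_le_imp_le)
  \<comment> \<open>\<open>T \<ge> 0\<close> is the boundary case \<open>c = 2 m\<close> with
    denominators cleared. Multiplying by \<open>k\<close> completes the square in \<open>s\<close>;
    \<open>k = 0\<close> forces \<open>m = u = 1\<close> and is treated directly.\<close>
  define T where "T = (1 - b * r * s)\<^sup>2 - m * u * (1 - s\<^sup>2) - (m * u * s)\<^sup>2"
  have "T * k = (k - b * r * s)\<^sup>2 + (1 - k) * (k\<^sup>2 - (b * r)\<^sup>2) * s\<^sup>2"
    by (simp add: T_def k_def power2_eq_square algebra_simps)
  moreover have "0 \<le> (k - b * r * s)\<^sup>2 + (1 - k) * (k\<^sup>2 - (b * r)\<^sup>2) * s\<^sup>2"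
    using brk k by simp
  ultimately have Tk: "0 \<le> T * k"
    by simp
  have T: "0 \<le> T"
  proof (cases "k = 0")
    case True
    moreover have "0 \<le> b * r"
      using b r by simp
    ultimately have "b * r = 0" "m * u = 1"
      using ks by (auto simp: k_def)
    then show ?thesis
      unfolding T_def by (simp only: mult_zero_left mult_1) simp
  next
    case False
    then show ?thesis
      using Tk k by (simp add: zero_le_mult_iff)
  qed
  have "b * s \<le> 1"
    using b s by (simp add: mult_le_one)
  then have "b * s * r \<le> 1 * r"
    using r by (intro mult_right_mono) auto
  then have pos: "0 < 1 - b * r * s"
    using r by (simp add: mult_ac)
  have us: "0 \<le> m * u * (1 - s\<^sup>2)"
    using m u s by (simp add: abs_square_le_1)
  \<comment> \<open>For general \<open>c\<close> the cleared claim reads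
    \<open>2 m (m u (1 - s^2)) \<le> c W\<close>. As \<open>W\<close> dominates the nonnegative
    bracket, \<open>2 m \<le> c\<close> suffices.\<close>
  define W where "W = (1 - b * r * s)\<^sup>2 - (m * u * s)\<^sup>2"
  have W: "m * u * (1 - s\<^sup>2) \<le> W"
    using T by (simp add: T_def W_def)
  have "m * (2 * m * (u * (1 - s\<^sup>2))) = 2 * m * (m * u * (1 - s\<^sup>2))"
    by simp
  also have "\<dots> \<le> c * W"
    using c W us m by (intro mult_mono) auto
  finally have "2 * m\<^sup>2 * (u * (1 - s\<^sup>2 + c / 2 * u * s\<^sup>2)) \<le> c * (1 - b * r * s)\<^sup>2"
    by (simp add: W_def power2_eq_square algebra_simps)
  then show ?thesis
    using pos m by (simp add: pick_bound_def u_def divide_le_eq le_divide_eq mult_ac)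
qed

section \<open>The sharp estimates\<close>

text \<open>For \<open>B = -1\<close> the extremal expressions become 0/0 at the boundary point 1.
  Here \<open>p\<close> is the continuous expression left after cancellation.\<close>

lemma LIMSEQ_of_continuous_at_1:
  fixes p :: "real \<Rightarrow> real"
  assumes "continuous_on UNIV p" "\<And>n. g n = p (real n / real (Suc n))" "p 1 = M"
  shows "g \<longlonglongrightarrow> M"
proof -
  have "isCont p 1"
    using assms(1) by (simp add: continuous_on_eq_continuous_at)
  then have "(\<lambda>n. p (real n / real (Suc n))) \<longlonglongrightarrow> p 1"
    by (rule isCont_tendsto_compose[OF _ LIMSEQ_n_over_Suc_n])
  then show ?thesis
    unfolding assms(2)[symmetric] assms(3) .
qed

lemma bound12_estimate:
  assumes AB: "-1 \<le> B" "B < A" "A \<le> 1" and f: "f \<in> class_C A B"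
  shows "schwarzian_norm f \<le> ereal (bound12 A B)"
proof (rule schwarzian_norm_le[OF f])
  show B: "\<bar>B\<bar> \<le> 1" and "B < A"
    using AB by auto
  fix r s :: real
  assume r: "0 \<le> r" "r < 1" and s: "0 \<le> s" "s \<le> 1"
  have c: "\<bar>A + B\<bar> < 2"
    using AB by auto
  have "(A - B) * pick_bound \<bar>A + B\<bar> \<bar>B\<bar> r s \<le> (A - B) * gamma_fun A B r"
    using AB pick_bound_le_gamma_fun[OF c B r s] by (intro mult_left_mono) auto
  also have "(A - B) * gamma_fun A B r \<le> bound12 A B"
  proof (cases "B = -1")
    case True
    have r2: "r\<^sup>2 < 1"
      using r by (simp add: abs_square_less_1)
    have cA: "\<bar>A + B\<bar> = 1 - A"
      using True AB by simp
    \<comment> \<open>For \<open>B = -1\<close> the denominator of \<open>\<gamma>\<close> contains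
      the factor \<open>1 - r^2\<close> of its numerator; what remains is affine in
      \<open>r^2\<close> and tends to 2 as \<open>r\<close> tends to 1.\<close>
    have "2 - (1 - A) * (1 - r\<^sup>2) - 2 * B\<^sup>2 * r\<^sup>2 = (A - B) * (1 - r\<^sup>2)"
      using True by (simp add: algebra_simps)
    then have "(A - B) * gamma_fun A B r = 2 - (1 - A) * (1 - r\<^sup>2)"
      unfolding gamma_fun_def cA using r2 AB by simp
    also have "\<dots> \<le> 2"
      using r2 AB by simp
    finally show ?thesis
      using True by (simp add: bound12_def)
  next
    case False
    show ?thesis
    proof (cases "\<bar>A + B\<bar> \<le> 2 * (1 - B\<^sup>2)")
      case True
      then show ?thesis
        using False AB gamma_fun_le_1[OF c B r True] by (simp add: bound12_def mult_left_le)
    next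
      case large: False
      have "\<exists>!t. 0 < t \<and> t < 1 \<and> h_poly A B t = 0"
        using large False AB c by (intro h_poly_unique_root) auto
      from theI'[OF this] have "gamma_fun A B r \<le> gamma_fun A B (alpha_root A B)"
        unfolding alpha_root_def by (intro gamma_fun_le_critical[OF c B r]) auto
      then show ?thesis
        using False large AB by (simp add: bound12_def)
    qed
  qed
  finally show "(A - B) * pick_bound \<bar>A + B\<bar> \<bar>B\<bar> r s \<le> bound12 A B" .
qed

text \<open>This places the maximiser \<open>s = \<bar>B\<bar> t / k\<close> below 1, so that a
  Schur function can take this value. In \<open>E1\<close> the quadratic
  \<open>c t^2 - 2 b t + 2 - c\<close> has negative discriminant; in \<open>E2\<close> it equals
  \<open>(1 - t) (2 b - c (1 + t)) + 2 (1 - b)\<close>, whose first term is nonnegative since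
  \<open>c \<le> b\<close>.\<close>

lemma critical_value_interior:
  assumes AB: "-1 < B" "B < A" "A \<le> 1" and E: "(A, B) \<in> E1 \<union> E2" and t: "0 < t" "t < 1"
  shows "\<bar>B\<bar> * t < 1 - \<bar>A + B\<bar> / 2 * (1 - t\<^sup>2)"
proof -
  define b c where "b = \<bar>B\<bar>" and "c = \<bar>A + B\<bar>"
  have b: "0 \<le> b" "b < 1" and c: "0 \<le> c"
    using AB by (auto simp: b_def c_def)
  have "0 < c * t\<^sup>2 - 2 * b * t + 2 - c"
    using E
  proof
    assume "(A, B) \<in> E1"
    then have "\<bar>c - 1\<bar> < sqrt (1 - B\<^sup>2)"
      by (auto simp: E1_def c_def)
    then have "\<bar>c - 1\<bar>\<^sup>2 < (sqrt (1 - B\<^sup>2))\<^sup>2"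
      by (intro power_strict_mono) auto
    then have disc: "b\<^sup>2 < c * (2 - c)"
    proof -
      have "B\<^sup>2 \<le> 1"
        using b by (simp add: b_def abs_square_le_1)
      then have "(c - 1)\<^sup>2 < 1 - B\<^sup>2"
        using \<open>\<bar>c - 1\<bar>\<^sup>2 < _\<close> by simp
      then show ?thesis
        by (simp add: b_def power2_eq_square algebra_simps)
    qed
    then have "0 < c"
      using c by (cases "c = 0") auto
    have "0 < (c * t - b)\<^sup>2 + (c * (2 - c) - b\<^sup>2)"
      using disc by (intro add_nonneg_pos) auto
    also have "\<dots> = c * (c * t\<^sup>2 - 2 * b * t + 2 - c)"
      by (simp add: power2_eq_square algebra_simps)
    finally show ?thesis
      using \<open>0 < c\<close> by (simp add: zero_less_mult_iff)
  next
    assume "(A, B) \<in> E2"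
    then have "c \<le> b"
      by (simp add: E2_def c_def b_def)
    then have "c * (1 + t) \<le> b * 2"
      using c t by (intro mult_mono) auto
    then have "0 \<le> (1 - t) * (2 * b - c * (1 + t))"
      using t by simp
    then show ?thesis
      using b by (simp add: power2_eq_square algebra_simps)
  qed
  then show ?thesis
    by (simp add: b_def c_def field_simps)
qed

lemma bound12_attained:
  assumes AB: "-1 \<le> B" "B < A" "A \<le> 1" and E: "(A, B) \<in> E1 \<union> E2"
  shows "\<exists>f\<in>class_C A B. schwarzian_norm f = ereal (bound12 A B)"
proof -
  have B: "\<bar>B\<bar> \<le> 1" and c2: "\<bar>A + B\<bar> < 2"
    using AB by auto
  note le = bound12_estimate[OF AB]
  consider "B = -1" | "B \<noteq> -1" "\<bar>A + B\<bar> \<le> 2 * (1 - B\<^sup>2)" | "B \<noteq> -1" "\<bar>A + B\<bar> > 2 * (1 - B\<^sup>2)"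
    by linarith
  then show ?thesis
  proof cases
    case 1
    \<comment> \<open>For \<open>B = -1\<close> the square root vanishes, so \<open>E1\<close> has
      no such point and \<open>E2\<close> requires \<open>1 - A \<le> 1\<close>.\<close>
    have A: "0 \<le> A"
      using E 1 AB by (auto simp: E1_def E2_def)
    \<comment> \<open>the derivative of the disk automorphism at the boundary point 1 is \<open>A\<close>, as equality
      in the majorant to first order at \<open>r = s = 1\<close> requires\<close>
    define p where "p = - (1 - A) / (1 + A)"
    have p: "\<bar>p\<bar> \<le> 1"
      using A AB by (simp add: p_def divide_le_eq)
    have one: "\<bar>1 :: real\<bar> = 1"
      by simp
    define x where "x n = real n / real (Suc n)" for n
    have x: "0 \<le> x n" "x n < 1" for n
      by (simp_all add: x_def)
    note \<phi> = real_Moebius[OF p one]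
    show ?thesis
    proof (rule schwarzian_norm_attained[OF le \<phi>(1) B AB(2), of x
          "\<lambda>n. 1 * (x n - p) / (1 - p * x n)" "\<lambda>n. 1 * (1 - p\<^sup>2) / (1 - p * x n)\<^sup>2"])
      show "\<bar>x n\<bar> < 1" for n
        using x[of n] by simp
      then show "deriv (\<lambda>z. of_real 1 * (z - of_real p) / (1 - of_real p * z)) (of_real (x n))
          = complex_of_real (1 * (1 - p\<^sup>2) / (1 - p * x n)\<^sup>2)" for n
        by (rule \<phi>(3))
      show "of_real 1 * (of_real (x n) - of_real p) / (1 - of_real p * of_real (x n))
          = complex_of_real (1 * (x n - p) / (1 - p * x n))" for n
        by (rule \<phi>(2))
      show "(\<lambda>n. (1 - (x n)\<^sup>2)\<^sup>2 * ((A - B) *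
               \<bar>1 * (1 - p\<^sup>2) / (1 - p * x n)\<^sup>2 - (A + B) / 2 * (1 * (x n - p) / (1 - p * x n))\<^sup>2\<bar>
                 / (1 + B * x n * (1 * (x n - p) / (1 - p * x n)))\<^sup>2)) \<longlonglongrightarrow> bound12 A B"
      proof (rule LIMSEQ_of_continuous_at_1[where p = "\<lambda>x. (A + 1) * (1 - p\<^sup>2 + (1 - A) / 2 * (x - p)\<^sup>2)"])
        show "(A + 1) * (1 - p\<^sup>2 + (1 - A) / 2 * (1 - p)\<^sup>2) = bound12 A B"
        proof -
          have "1 - p = 2 / (1 + A)" "1 + p = A * (2 / (1 + A))"
            using A by (simp_all add: p_def field_simps)
          moreover have "1 - p\<^sup>2 = (1 - p) * (1 + p)"
            by (simp add: power2_eq_square algebra_simps)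
          ultimately have "1 - p\<^sup>2 + (1 - A) / 2 * (1 - p)\<^sup>2
              = 2 / (1 + A) * (A * (2 / (1 + A))) + (1 - A) / 2 * (2 / (1 + A))\<^sup>2"
            by simp
          also have "\<dots> = (2 / (1 + A))\<^sup>2 * ((1 + A) / 2)"
            by (simp add: power2_eq_square algebra_simps add_divide_distrib diff_divide_distrib)
          also have "\<dots> = 2 / (1 + A)"
            using A by (simp add: power2_eq_square divide_eq_eq eq_divide_eq)
          finally show ?thesis
            using A 1 by (simp add: bound12_def divide_eq_eq)
        qed
        fix n
        define X K where "X = x n" and "K = 1 - p * X"
        have X: "0 \<le> X" "X < 1" and X2: "X\<^sup>2 < 1"
          using x[of n] by (simp_all add: X_def abs_square_less_1)
        have "p \<le> 0"
          using A AB by (simp add: p_def divide_le_0_iff)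
        then have K: "0 < K"
          using X mult_nonpos_nonneg[of p X] by (simp add: K_def)
        have den: "1 + B * X * (1 * (X - p) / K) = (1 - X\<^sup>2) / K"
          using K 1 by (simp add: K_def field_simps power2_eq_square)
        have num: "1 * (1 - p\<^sup>2) / K\<^sup>2 - (A + B) / 2 * (1 * (X - p) / K)\<^sup>2
            = (1 - p\<^sup>2 + (1 - A) / 2 * (X - p)\<^sup>2) / K\<^sup>2"
          using K 1 by (simp add: field_simps power2_eq_square)
        have "0 \<le> 1 - p\<^sup>2 + (1 - A) / 2 * (X - p)\<^sup>2"
          using p AB by (simp add: abs_square_le_1)
        then have "(1 - X\<^sup>2)\<^sup>2 * ((A - B) *
               \<bar>1 * (1 - p\<^sup>2) / K\<^sup>2 - (A + B) / 2 * (1 * (X - p) / K)\<^sup>2\<bar>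
                 / (1 + B * X * (1 * (X - p) / K))\<^sup>2)
            = (A + 1) * (1 - p\<^sup>2 + (1 - A) / 2 * (X - p)\<^sup>2)"
          unfolding den num using K X2 1 by (simp add: power_divide)
        then show "(1 - (x n)\<^sup>2)\<^sup>2 * ((A - B) *
               \<bar>1 * (1 - p\<^sup>2) / (1 - p * x n)\<^sup>2 - (A + B) / 2 * (1 * (x n - p) / (1 - p * x n))\<^sup>2\<bar>
                 / (1 + B * x n * (1 * (x n - p) / (1 - p * x n)))\<^sup>2)
            = (A + 1) * (1 - p\<^sup>2 + (1 - A) / 2 * (real n / real (Suc n) - p)\<^sup>2)"
          by (simp only: X_def K_def x_def)
      qed (intro continuous_intros)
    qed
  next
    case 2
    \<comment> \<open>Here \<open>\<gamma>\<close> is largest at 0, so a function with value 0 and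
      derivative 1 at the origin attains the bound there.\<close>
    obtain \<phi> where "\<phi> \<in> schur" "\<phi> (of_real 0) = of_real 0" "deriv \<phi> (of_real 0) = of_real (1 * (1 - 0\<^sup>2) / (1 - 0\<^sup>2))"
      using Schwarz_Pick_equality[of 0 0 1] by auto
    then show ?thesis
      using 2 AB B
      by (intro schwarzian_norm_attained[OF le, where \<phi> = \<phi> and x = "\<lambda>_. 0" and y = "\<lambda>_. 0" and d = "\<lambda>_. 1"]) (auto simp: bound12_def)
  next
    case 3
    define t where "t = alpha_root A B"
    have "\<exists>!t. 0 < t \<and> t < 1 \<and> h_poly A B t = 0"
      using 3 AB c2 by (intro h_poly_unique_root) auto
    from theI'[OF this] have t: "0 < t" "t < 1"
      by (auto simp: t_def alpha_root_def)
    define k where "k = 1 - \<bar>A + B\<bar> / 2 * (1 - t\<^sup>2)"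
    have kt: "\<bar>B\<bar> * t < k"
      unfolding k_def using 3 AB E t by (intro critical_value_interior) auto
    then have k: "0 < k"
      using t by (smt (verit) mult_nonneg_nonneg)
    \<comment> \<open>The modulus is the maximiser in \<open>s\<close>, and the sign makes
      \<open>B t \<sigma>\<close> nonpositive, giving the smallest denominator. The sign
      \<open>\<eta>\<close> opposes that of \<open>A + B\<close>, so the two numerator terms add
      up.\<close>
    define \<sigma> where "\<sigma> = - B * t / k"
    define \<eta> :: real where "\<eta> = (if 0 \<le> A + B then -1 else 1)"
    have \<sigma>: "\<bar>\<sigma>\<bar> < 1"
      using kt k t by (simp add: \<sigma>_def abs_mult)
    have \<sigma>2: "\<sigma>\<^sup>2 < 1" and t2: "t\<^sup>2 < 1"
      using \<sigma> t by (simp_all add: abs_square_less_1)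
    obtain \<phi> where \<phi>: "\<phi> \<in> schur" "\<phi> (of_real t) = of_real \<sigma>"
      "deriv \<phi> (of_real t) = of_real (\<eta> * (1 - \<sigma>\<^sup>2) / (1 - t\<^sup>2))"
      by (rule Schwarz_Pick_equality[of t \<sigma> \<eta>]) (use t \<sigma> in \<open>auto simp: \<eta>_def\<close>)
    have "\<eta> * (1 - \<sigma>\<^sup>2) / (1 - t\<^sup>2) - (A + B) / 2 * \<sigma>\<^sup>2
        = \<eta> * ((1 - \<sigma>\<^sup>2) / (1 - t\<^sup>2) + \<bar>A + B\<bar> / 2 * \<sigma>\<^sup>2)"
    proof -
      have "- (A + B) = \<eta> * \<bar>A + B\<bar>"
        by (simp add: \<eta>_def)
      then have "- ((A + B) / 2 * \<sigma>\<^sup>2) = \<eta> * (\<bar>A + B\<bar> / 2 * \<sigma>\<^sup>2)"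
        by (metis minus_divide_left minus_mult_left mult.assoc times_divide_eq_right)
      then show ?thesis
        by (simp add: distrib_left)
    qed
    moreover have "0 \<le> (1 - \<sigma>\<^sup>2) / (1 - t\<^sup>2) + \<bar>A + B\<bar> / 2 * \<sigma>\<^sup>2"
      using \<sigma>2 t2 by simp
    ultimately have "\<bar>\<eta> * (1 - \<sigma>\<^sup>2) / (1 - t\<^sup>2) - (A + B) / 2 * \<sigma>\<^sup>2\<bar>
        = (1 - \<sigma>\<^sup>2) / (1 - t\<^sup>2) + \<bar>A + B\<bar> / 2 * \<sigma>\<^sup>2"
      by (simp only: abs_mult abs_of_nonneg) (simp add: \<eta>_def)
    also have "\<dots> = (1 - k * \<sigma>\<^sup>2) / (1 - t\<^sup>2)"
      using t2 by (simp add: k_def field_simps)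
    also have "1 - k * \<sigma>\<^sup>2 = (k - B\<^sup>2 * t\<^sup>2) / k"
      using k by (simp add: \<sigma>_def field_simps power2_eq_square)
    finally have num: "\<bar>\<eta> * (1 - \<sigma>\<^sup>2) / (1 - t\<^sup>2) - (A + B) / 2 * \<sigma>\<^sup>2\<bar>
        = (k - B\<^sup>2 * t\<^sup>2) / k / (1 - t\<^sup>2)" .
    have den: "1 + B * t * \<sigma> = (k - B\<^sup>2 * t\<^sup>2) / k"
      using k by (simp add: \<sigma>_def field_simps power2_eq_square)
    have D: "0 < k - B\<^sup>2 * t\<^sup>2"
      using gamma_denominator_pos[of "\<bar>A + B\<bar>" B "t\<^sup>2"] c2 B t2 by (simp add: k_def abs_square_le_1 field_simps)
    have "(1 - t\<^sup>2)\<^sup>2 * ((A - B) * \<bar>\<eta> * (1 - \<sigma>\<^sup>2) / (1 - t\<^sup>2) - (A + B) / 2 * \<sigma>\<^sup>2\<bar> / (1 + B * t * \<sigma>)\<^sup>2)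
        = (A - B) * ((1 - t\<^sup>2) * k / (k - B\<^sup>2 * t\<^sup>2))"
    proof -
      have "u\<^sup>2 * (a * (w / k / u) / (w / k)\<^sup>2) = a * (u * k / w)" if "u > 0" "w > 0" for u w a :: real
        using that k by (simp add: field_simps power2_eq_square)
      then show ?thesis
        unfolding num den using t2 D by simp
    qed
    also have "(1 - t\<^sup>2) * k / (k - B\<^sup>2 * t\<^sup>2) = (1 - t\<^sup>2) * (2 * k) / (2 * (k - B\<^sup>2 * t\<^sup>2))"
      using mult_divide_mult_cancel_left[of 2 "(1 - t\<^sup>2) * k" "k - B\<^sup>2 * t\<^sup>2"] by (simp add: mult_ac)
    also have "\<dots> = gamma_fun A B t"
    proof -
      have "2 * k = 2 - \<bar>A + B\<bar> * (1 - t\<^sup>2)"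
        "2 * (k - B\<^sup>2 * t\<^sup>2) = 2 - \<bar>A + B\<bar> * (1 - t\<^sup>2) - 2 * B\<^sup>2 * t\<^sup>2"
        by (simp_all add: k_def field_simps)
      then show ?thesis
        by (simp add: gamma_fun_def)
    qed
    also have "(A - B) * \<dots> = bound12 A B"
      using 3 by (simp add: bound12_def t_def)
    finally have "(1 - t\<^sup>2)\<^sup>2 * ((A - B) * \<bar>\<eta> * (1 - \<sigma>\<^sup>2) / (1 - t\<^sup>2) - (A + B) / 2 * \<sigma>\<^sup>2\<bar>
        / (1 + B * t * \<sigma>)\<^sup>2) = bound12 A B" .
    then show ?thesis
      using \<phi> t AB B
      by (intro schwarzian_norm_attained[OF le, where \<phi> = \<phi> and x = "\<lambda>_. t"
            and y = "\<lambda>_. \<sigma>" and d = "\<lambda>_. \<eta> * (1 - \<sigma>\<^sup>2) / (1 - t\<^sup>2)"])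
        auto
  qed
qed

lemma bound3_eq:
  assumes AB: "-1 \<le> B" "B < A" "A \<le> 1" and E: "(A, B) \<in> E3"
  defines "w \<equiv> sqrt (1 - B\<^sup>2)"
  shows "bound3 A B = (A - B) * (2 * \<bar>A + B\<bar> / (1 + w)\<^sup>2)"
    and "0 \<le> w" "w < 1" "w\<^sup>2 = 1 - B\<^sup>2" "1 + w \<le> \<bar>A + B\<bar>"
proof -
  have b: "B\<^sup>2 \<le> 1"
    using AB by (simp add: abs_square_le_1)
  then show w0: "0 \<le> w" and w2: "w\<^sup>2 = 1 - B\<^sup>2"
    by (simp_all add: w_def)
  show cw: "1 + w \<le> \<bar>A + B\<bar>"
    using E by (simp add: E3_def w_def)
  \<comment> \<open>Since \<open>\<bar>A + B\<bar> < 2\<close>, this excludes \<open>B = 0\<close>,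
    so the division by \<open>B^4\<close> in \<open>bound3\<close> is genuine and
    \<open>(1 - w)^2\<close> can be cancelled.\<close>
  then show w1: "w < 1"
    using AB by auto
  have "B\<^sup>2 = (1 - w) * (1 + w)"
    using w2 by (simp add: power2_eq_square algebra_simps)
  then have "B ^ 4 = (1 - w)\<^sup>2 * (1 + w)\<^sup>2"
    by (metis numeral_Bit0 power2_eq_square power_add power_mult_distrib)
  moreover have "\<bar>A\<^sup>2 - B\<^sup>2\<bar> = (A - B) * \<bar>A + B\<bar>"
  proof -
    have "A\<^sup>2 - B\<^sup>2 = (A - B) * (A + B)"
      by (simp add: power2_eq_square algebra_simps)
    then show ?thesis
      using AB by (simp add: abs_mult)
  qed
  ultimately show "bound3 A B = (A - B) * (2 * \<bar>A + B\<bar> / (1 + w)\<^sup>2)"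
    using w1 by (simp add: bound3_def flip: w_def)
qed

lemma bound3_estimate:
  assumes AB: "-1 \<le> B" "B < A" "A \<le> 1" and E: "(A, B) \<in> E3" and f: "f \<in> class_C A B"
  shows "schwarzian_norm f \<le> ereal (bound3 A B)"
proof (rule schwarzian_norm_le[OF f])
  show B: "\<bar>B\<bar> \<le> 1" and "B < A"
    using AB by auto
  fix r s :: real
  assume r: "0 \<le> r" "r < 1" and s: "0 \<le> s" "s \<le> 1"
  define w where "w = sqrt (1 - B\<^sup>2)"
  note w = bound3_eq[OF AB E, folded w_def]
  \<comment> \<open>With this choice \<open>B^2 = 1 - w^2\<close> becomes
    \<open>4 m (1 - m)\<close>, and the inequality defining \<open>E3\<close> becomes
    \<open>2 m \<le> \<bar>A + B\<bar>\<close>.\<close>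
  define m where "m = (1 + w) / 2"
  have "pick_bound \<bar>A + B\<bar> \<bar>B\<bar> r s \<le> \<bar>A + B\<bar> / (2 * m\<^sup>2)"
  proof (rule pick_bound_le_E3[OF _ _ _ B _ _ r s])
    show "\<bar>B\<bar>\<^sup>2 = 4 * m * (1 - m)"
      using w(4) by (simp add: m_def power2_eq_square field_simps)
  qed (use w in \<open>simp_all add: m_def\<close>)
  also have "\<bar>A + B\<bar> / (2 * m\<^sup>2) = 2 * \<bar>A + B\<bar> / (1 + w)\<^sup>2"
    by (simp add: m_def power_divide)
  finally show "(A - B) * pick_bound \<bar>A + B\<bar> \<bar>B\<bar> r s \<le> bound3 A B"
    unfolding w(1) using AB by (intro mult_left_mono) auto
qed

text \<open>For \<open>\<phi> = 1\<close> the weighted Schwarzian at real \<open>x\<close> is a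
  constant times the square of \<open>(1 - x^2) / (1 + B x)\<close>. Its critical point is interior
  unless \<open>B = -1\<close>, when it moves to 1 and the bound is only approached along the
  sequence.\<close>

lemma bound3_attained:
  assumes AB: "-1 \<le> B" "B < A" "A \<le> 1" and E: "(A, B) \<in> E3"
  shows "\<exists>f\<in>class_C A B. schwarzian_norm f = ereal (bound3 A B)"
proof -
  have B: "\<bar>B\<bar> \<le> 1"
    using AB by auto
  note le = bound3_estimate[OF AB E]
  define w where "w = sqrt (1 - B\<^sup>2)"
  note w = bound3_eq[OF AB E, folded w_def]
  have one: "(\<lambda>_. 1) \<in> schur"
    by (simp add: schur_def)
  have c: "\<bar>(A + B) / 2\<bar> = \<bar>A + B\<bar> / 2"
    by simp
  have attained: ?thesis if x: "\<And>n. \<bar>x n\<bar> < 1"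
    and lim: "(\<lambda>n. (1 - (x n)\<^sup>2)\<^sup>2 * ((A - B) * (\<bar>A + B\<bar> / 2) / (1 + B * x n)\<^sup>2)) \<longlonglongrightarrow> bound3 A B"
    for x :: "nat \<Rightarrow> real"
    by (rule schwarzian_norm_attained[OF le one B AB(2), of x "\<lambda>_. 1" "\<lambda>_. 0"])
      (use x lim c in simp_all)
  show ?thesis
  proof (cases "B = -1")
    case True
    show ?thesis
    proof (rule attained[of "\<lambda>n. real n / real (Suc n)"])
      show "\<bar>real n / real (Suc n)\<bar> < 1" for n
        by simp
      show "(\<lambda>n. (1 - (real n / real (Suc n))\<^sup>2)\<^sup>2 * ((A - B) * (\<bar>A + B\<bar> / 2)
          / (1 + B * (real n / real (Suc n)))\<^sup>2)) \<longlonglongrightarrow> bound3 A B"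
      proof (rule LIMSEQ_of_continuous_at_1[where p = "\<lambda>x. (A - B) * (\<bar>A + B\<bar> / 2) * (1 + x)\<^sup>2"])
        show "(A - B) * (\<bar>A + B\<bar> / 2) * (1 + 1)\<^sup>2 = bound3 A B"
          using w(1) True by (simp add: w_def)
        fix n
        have *: "(1 - x\<^sup>2)\<^sup>2 * (a / (1 + B * x)\<^sup>2) = a * (1 + x)\<^sup>2" if "x < 1" for x a :: real
        proof -
          have "1 - x\<^sup>2 = (1 + x) * (1 + B * x)"
            using True by (simp add: power2_eq_square algebra_simps)
          moreover have "1 + B * x \<noteq> 0"
            using True that by simp
          ultimately show ?thesis
            by (simp add: power_mult_distrib)
        qed
        show "(1 - (real n / real (Suc n))\<^sup>2)\<^sup>2 * ((A - B) * (\<bar>A + B\<bar> / 2)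
            / (1 + B * (real n / real (Suc n)))\<^sup>2)
            = (A - B) * (\<bar>A + B\<bar> / 2) * (1 + real n / real (Suc n))\<^sup>2"
          by (rule *) simp
      qed (intro continuous_intros)
    qed
  next
    case False
    have "B\<^sup>2 < 1"
      using False AB by (simp add: abs_square_less_1)
    then have w0: "0 < w"
      by (simp add: w_def)
    have B0: "B \<noteq> 0"
      using w(3,4) by (auto simp: w_def)
    \<comment> \<open>the critical point of \<open>(1 - x\<^sup>2) / (1 + B x)\<close>\<close>
    define x where "x = - (1 - w) / B"
    have Bx: "1 + B * x = w"
      using B0 by (simp add: x_def)
    have "B\<^sup>2 = (1 - w) * (1 + w)"
      using w(4) by (simp add: power2_eq_square algebra_simps)
    then have "x\<^sup>2 = (1 - w)\<^sup>2 / ((1 - w) * (1 + w))"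
      by (simp add: x_def power_divide power2_commute)
    also have "\<dots> = (1 - w) / (1 + w)"
      using w(3) by (simp add: power2_eq_square)
    finally have x2: "1 - x\<^sup>2 = 2 * w / (1 + w)"
      using w0 by (simp add: field_simps)
    have "0 < 1 - x\<^sup>2"
      unfolding x2 using w0 by simp
    then have x1: "\<bar>x\<bar> < 1"
      by (simp add: abs_square_less_1)
    have "(1 - x\<^sup>2)\<^sup>2 * ((A - B) * (\<bar>A + B\<bar> / 2) / (1 + B * x)\<^sup>2) = bound3 A B"
      unfolding w(1) Bx x2 using w0 by (simp add: power_divide power_mult_distrib)
    then show ?thesis
      using attained[of "\<lambda>_. x"] x1 by simp
  qed
qed

theorem theorem2p2:
  fixes A B :: real
  assumes "-1 \<le> B" and "B < A" and "A \<le> 1"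
  shows "((A,B) \<in> E1 \<union> E2 \<longrightarrow>
            ((B \<noteq> -1 \<and> \<bar>A+B\<bar> > 2*(1 - B^2)) \<longrightarrow>
                 (\<exists>!t. 0 < t \<and> t < 1 \<and> h_poly A B t = 0)) \<and>
            (\<forall>f\<in>class_C A B. schwarzian_norm f \<le> ereal (bound12 A B)) \<and>
            (\<exists>f\<in>class_C A B. schwarzian_norm f = ereal (bound12 A B)))
       \<and> ((A,B) \<in> E3 \<longrightarrow>
            (\<forall>f\<in>class_C A B. schwarzian_norm f \<le> ereal (bound3 A B)) \<and>
            (\<exists>f\<in>class_C A B. schwarzian_norm f = ereal (bound3 A B)))"
proof -
  have "\<exists>!t. 0 < t \<and> t < 1 \<and> h_poly A B t = 0" if "B \<noteq> -1" "\<bar>A+B\<bar> > 2*(1 - B^2)"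
    using assms that by (intro h_poly_unique_root) auto
  then show ?thesis
    using bound12_estimate[OF assms] bound12_attained[OF assms]
      bound3_estimate[OF assms] bound3_attained[OF assms]
    by blast
qed

end
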